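(* Let $k\ge 0$ and $\ell\ge 1$ be integers. Let $T$ be an oriented tree with $k$ edges and let $D$ be an oriented graph with $\delta^0(D)\ge \max\{k/\ell,\Delta(T)\}$. If the girth of $D$ is at least $2\ell+1$, then $D$ contains $T$ as a subgraph.
   Context: Digraphs have a nonempty vertex set and no loops or parallel arcs (a pair of opposite arcs $(x,y),(y,x)$ is allowed in a digraph). An oriented graph is a digraph with no directed cycle of length two, i.e. at most one of $(x,y),(y,x)$ is an arc for each pair of vertices. An oriented tree is an orientation of an undirected tree. The minimum semidegree $\delta^0(D)$ is the minimum of all in-degrees and all out-degrees of the vertices of $D$. The maximum degree $\Delta(T)$ is the maximum degree of the underlying undirected graph of $T$. The girth of an oriented graph $D$ is the length of a shortest cycle in its underlying undirected graph (so girth at least $2\ell+1$ means that $D$ contains no orientation whatsoever of a cycle of length between $3$ and $2\ell$). $D$ contains $T$ if there is an injective map $f\colon V(T)\to V(D)$ such that $(f(u),f(v))$ is an arc of $D$ for every arc $(u,v)$ of $T$. *)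

theory Defs
  imports "Graph_Theory.Graph_Theory" "HOL-Library.Extended_Nat" Complex_Main
begin

text \<open>
  Digraphs are pair digraphs, which cannot have parallel arcs. The underlying undirected graph
  of a digraph is its symmetric closure \<^term>\<open>mk_symmetric\<close>, in which an undirected edge is a
  pair of opposite arcs.
\<close>

definition oriented_graph :: "'a pair_pre_digraph \<Rightarrow> bool" where
  "oriented_graph G \<longleftrightarrow>
     pair_loopfree_digraph G \<and> pverts G \<noteq> {} \<and>
     (\<forall>u v. (u, v) \<in> parcs G \<longrightarrow> (v, u) \<notin> parcs G)"

text \<open>
  In a symmetric digraph, traversing an arc and then its opposite is a directed cycle of length
  two. It does not correspond to an undirected cycle, hence the lower bound on the length.
\<close>

definition underlying_cycle :: "'a pair_pre_digraph \<Rightarrow> ('a \<times> 'a) awalk \<Rightarrow> bool" where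
  "underlying_cycle G p \<longleftrightarrow>
     pre_digraph.cycle (with_proj (mk_symmetric (with_proj G))) p \<and> 3 \<le> length p"

text \<open>The girth is \<open>\<infinity>\<close> if there is no cycle.\<close>

definition girth :: "'a pair_pre_digraph \<Rightarrow> enat" where
  "girth G = (INF p \<in> {p. underlying_cycle G p}. enat (length p))"

text \<open>
  The predicate \<^const>\<open>connected\<close> of digraphs is connectedness of the symmetric closure.
\<close>

definition oriented_tree :: "'a pair_pre_digraph \<Rightarrow> bool" where
  "oriented_tree T \<longleftrightarrow>
     oriented_graph T \<and> finite (pverts T) \<and> Digraph_Component.connected (with_proj T) \<and>
     (\<nexists>p. underlying_cycle T p)"

text \<open>
  The infimum of a nonempty set of natural numbers is its minimum, also when the set is infinite.
  A vertex with infinitely many incoming (outgoing) arcs has \<^const>\<open>in_degree\<close>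
  (\<^const>\<open>out_degree\<close>) 0.
\<close>

definition min_semidegree :: "'a pair_pre_digraph \<Rightarrow> nat" where
  "min_semidegree G =
     Inf (in_degree (with_proj G) ` pverts G \<union> out_degree (with_proj G) ` pverts G)"

definition max_degree :: "'a pair_pre_digraph \<Rightarrow> nat" where
  "max_degree G = Max (out_degree (with_proj (mk_symmetric (with_proj G))) ` pverts G)"

definition contains_digraph :: "'a pair_pre_digraph \<Rightarrow> 'b pair_pre_digraph \<Rightarrow> bool" where
  "contains_digraph D T \<longleftrightarrow>
     (\<exists>f. inj_on f (pverts T) \<and> f ` pverts T \<subseteq> pverts D \<and>
          (\<forall>(u, v) \<in> parcs T. (f u, f v) \<in> parcs D))"

end

theory Submission
  imports Defs
begin

text \<open>
  The proof is by induction on the number of vertices of the tree. Write \<open>d\<close> for the minimum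
  semidegree of \<open>D\<close>, so that \<open>T\<close> has at most \<open>\<ell> d + 1\<close> vertices.

  The working notion is that of a \<^emph>\<open>local embedding\<close>: an arc-preserving map that is injective on
  the neighbourhood of every vertex. As \<open>\<Delta>(T) \<le> d\<close>, a local embedding of a subtree
  extends greedily to the whole of \<open>T\<close> (\<open>local_embedding_extend\<close>). A local embedding maps the
  paths of \<open>T\<close> to non-backtracking walks of \<open>D\<close>, and a closed non-backtracking walk contains a
  cycle, so two vertices at distance at most \<open>2 \<ell>\<close> never have the same image. Hence a tree of
  diameter less than \<open>2 \<ell>\<close> is embedded by any local embedding.

  Otherwise choose a root that maximises the height of \<open>T\<close>, let \<open>w\<close> be a deepest vertex, so that
  its depth is at least \<open>2 \<ell>\<close>, and let \<open>f\<close> be an embedding of \<open>T - w\<close>. Let \<open>a\<close> be the ancestor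
  of \<open>w\<close> at distance \<open>\<ell>\<close>, and consider one of the last \<open>\<ell>\<close> edges \<open>u v\<close> of the path from the root
  to \<open>w\<close>, with \<open>u\<close> the parent of \<open>v\<close>. If \<open>u\<close> has \<open>c\<close> children, then \<open>f u\<close> has at least \<open>d - 1 - c\<close>
  neighbours \<open>y\<close> in the direction of the edge that are not the image of a neighbour of \<open>u\<close>; for
  the last edge there are at least \<open>d - c\<close>, because \<open>w\<close> has no image. Send \<open>v\<close> to \<open>y\<close>,
  rebuild the part of the tree below \<open>v\<close>, and suppose that this never gives an embedding. As the
  part of the tree below \<open>a\<close> has height at most \<open>\<ell>\<close>, the collision is with the image of a vertex
  \<open>q\<close> that is not below \<open>a\<close> (\<open>collision_exists\<close>). Different pairs of an edge and a vertex \<open>y\<close> give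
  different \<open>q\<close>, since a non-backtracking walk of length at most \<open>\<ell>\<close> is determined by its ends
  (\<open>collision_unique\<close>), and \<open>q\<close> is none of the \<open>\<ell>\<close> nearest ancestors of \<open>a\<close>, which are too close
  to the vertex colliding with it (\<open>collision_far\<close>).

  So \<open>T\<close> has \<open>\<ell>\<close> ancestors of \<open>a\<close>, at least \<open>\<Sum>(d - 1 - c) + 1\<close> vertices \<open>q\<close>, the vertex \<open>a\<close>
  itself, and below it the \<open>\<Sum>c\<close> children of the vertices \<open>u\<close>. These are disjoint
  sets, so the sizes \<open>c\<close> cancel and \<open>T\<close> has at least \<open>\<ell> d + 2\<close> vertices, a contradiction
  (\<open>too_many_vertices\<close>).
\<close>

section \<open>Non-backtracking walks and girth\<close>

definition adj :: "('v \<times> 'v) set \<Rightarrow> 'v \<Rightarrow> 'v \<Rightarrow> bool" where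
  "adj A u v \<longleftrightarrow> (u, v) \<in> A \<or> (v, u) \<in> A"

text \<open>
  Walks are functions restricted to \<open>{0..n}\<close>, which makes segments, reversals and images under a
  map of vertices plain compositions.
\<close>

definition nb_walk :: "('v \<Rightarrow> 'v \<Rightarrow> bool) \<Rightarrow> nat \<Rightarrow> (nat \<Rightarrow> 'v) \<Rightarrow> bool" where
  "nb_walk R n P \<longleftrightarrow>
     (\<forall>i<n. R (P i) (P (Suc i))) \<and> (\<forall>i. Suc (Suc i) \<le> n \<longrightarrow> P i \<noteq> P (Suc (Suc i)))"

definition girth_exceeds :: "('v \<Rightarrow> 'v \<Rightarrow> bool) \<Rightarrow> nat \<Rightarrow> bool" where
  "girth_exceeds R n \<longleftrightarrow> (\<forall>m P. nb_walk R m P \<longrightarrow> 0 < m \<longrightarrow> m \<le> n \<longrightarrow> P 0 \<noteq> P m)"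

lemma adj_sym: "adj A u v \<longleftrightarrow> adj A v u"
  by (auto simp: adj_def)

lemma symp_adj: "symp (adj A)"
  by (auto simp: adj_def symp_def)

lemma girth_exceeds_mono: "girth_exceeds R n \<Longrightarrow> m \<le> n \<Longrightarrow> girth_exceeds R m"
  by (auto simp: girth_exceeds_def)

lemma nb_walk_segment:
  assumes "nb_walk R n P" "i + m \<le> n"
  shows "nb_walk R m (\<lambda>t. P (i + t))"
  using assms unfolding nb_walk_def by auto

lemma nb_walk_neq:
  assumes "girth_exceeds R n" "nb_walk R m P" "i < j" "j \<le> m" "j - i \<le> n"
  shows "P i \<noteq> P j"
proof -
  have "nb_walk R (j - i) (\<lambda>t. P (i + t))"
    using assms by (intro nb_walk_segment[where n = m]) auto
  with assms(1,3,5) have "P (i + 0) \<noteq> P (i + (j - i))"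
    unfolding girth_exceeds_def by (metis zero_less_diff)
  with assms(3) show ?thesis by simp
qed

text \<open>
  The reversal of one walk followed by another one from the same start backtracks only if both
  walks begin with the same step.
\<close>

lemma nb_walk_join:
  assumes "symp R" "nb_walk R m P" "nb_walk R n Q" "P 0 = Q 0"
    and "0 < m \<Longrightarrow> 0 < n \<Longrightarrow> P 1 \<noteq> Q 1"
  shows "nb_walk R (m + n) (\<lambda>t. if t \<le> m then P (m - t) else Q (t - m))"
    (is "nb_walk R _ ?Z")
  unfolding nb_walk_def
proof (intro conjI allI impI)
  fix i assume i: "i < m + n"
  consider "Suc i \<le> m" | "i = m" | "m < i" by linarith
  then show "R (?Z i) (?Z (Suc i))"
  proof cases
    case 1
    then have "R (P (m - Suc i)) (P (Suc (m - Suc i)))"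
      using assms(2) by (simp add: nb_walk_def)
    with 1 show ?thesis using assms(1) by (simp add: Suc_diff_Suc sympD)
  next
    case 2
    with i have "R (Q 0) (Q (Suc 0))" using assms(3) by (simp add: nb_walk_def)
    with 2 assms(4) show ?thesis by simp
  next
    case 3
    with i have "R (Q (i - m)) (Q (Suc (i - m)))" using assms(3) by (simp add: nb_walk_def)
    with 3 show ?thesis by (simp add: Suc_diff_le)
  qed
next
  fix i assume i: "Suc (Suc i) \<le> m + n"
  consider "Suc (Suc i) \<le> m" | "Suc i = m" | "m \<le> i" by linarith
  then show "?Z i \<noteq> ?Z (Suc (Suc i))"
  proof cases
    case 1
    then have "P (m - Suc (Suc i)) \<noteq> P (Suc (Suc (m - Suc (Suc i))))"
      using assms(2) by (simp add: nb_walk_def)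
    moreover have "Suc (Suc (m - Suc (Suc i))) = m - i" using 1 by simp
    ultimately show ?thesis using 1 by simp
  next
    case 2
    with i assms(5) show ?thesis by auto
  next
    case 3
    with i have "Q (i - m) \<noteq> Q (Suc (Suc (i - m)))" using assms(3) by (simp add: nb_walk_def)
    with 3 show ?thesis using assms(4) by (auto simp: Suc_diff_le)
  qed
qed

lemma nb_walk_rev:
  assumes "symp R" "nb_walk R m P"
  shows "nb_walk R m (\<lambda>t. P (m - t))"
  unfolding nb_walk_def
proof (intro conjI allI impI)
  fix i assume "i < m"
  then have "m - i = Suc (m - Suc i)" "m - Suc i < m" by auto
  then show "R (P (m - i)) (P (m - Suc i))"
    using assms by (metis nb_walk_def sympD)
next
  fix i assume "Suc (Suc i) \<le> m"
  then have "m - i = Suc (Suc (m - Suc (Suc i)))" "m - i \<le> m" by auto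
  then show "P (m - i) \<noteq> P (m - Suc (Suc i))"
    using assms(2) by (metis nb_walk_def)
qed

text \<open>
  Below the girth, walks without backtracking behave as in a tree. At the first place where the two
  walks separate, the reversed rest of one and the rest of the other join to a closed walk that is
  too short.
\<close>

lemma nb_walk_unique:
  assumes "symp R" "girth_exceeds R (m + n)" "nb_walk R m P" "nb_walk R n Q"
    and "P 0 = Q 0" "P m = Q n"
  shows "m = n \<and> (\<forall>i\<le>m. P i = Q i)"
  using assms(2-)
proof (induction m arbitrary: n P Q)
  case 0
  then have "n = 0" unfolding girth_exceeds_def by (metis add_0 le_refl neq0_conv)
  with 0 show ?case by simp
next
  case (Suc m)
  have "n \<noteq> 0"
  proof
    assume "n = 0"
    with Suc.prems show False unfolding girth_exceeds_def
      by (metis add_0_right le_refl zero_less_Suc)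
  qed
  then obtain n' where n: "n = Suc n'" by (cases n) auto
  show ?case
  proof (cases "P 1 = Q 1")
    case True
    have "nb_walk R m (\<lambda>t. P (1 + t))" "nb_walk R n' (\<lambda>t. Q (1 + t))"
      using Suc.prems n nb_walk_segment[of R "Suc m" P 1 m] nb_walk_segment[of R "Suc n'" Q 1 n']
      by auto
    moreover have "girth_exceeds R (m + n')"
      using Suc.prems(1) by (rule girth_exceeds_mono) (simp add: n)
    ultimately have *: "m = n' \<and> (\<forall>i\<le>m. P (1 + i) = Q (1 + i))"
      using Suc.IH[of n' "\<lambda>t. P (1 + t)" "\<lambda>t. Q (1 + t)"] True Suc.prems(5) n by simp
    then have "P i = Q i" if "i \<le> Suc m" for i
      using that Suc.prems(4) by (cases i) auto
    with * n show ?thesis by simp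
  next
    case False
    have "nb_walk R (Suc m + n) (\<lambda>t. if t \<le> Suc m then P (Suc m - t) else Q (t - Suc m))"
      using assms(1) Suc.prems False by (intro nb_walk_join) auto
    with Suc.prems(1) have
      "(\<lambda>t. if t \<le> Suc m then P (Suc m - t) else Q (t - Suc m)) 0
       \<noteq> (\<lambda>t. if t \<le> Suc m then P (Suc m - t) else Q (t - Suc m)) (Suc m + n)"
      unfolding girth_exceeds_def by blast
    with Suc.prems(5) n show ?thesis by simp
  qed
qed

section \<open>Rooted oriented trees\<close>

text \<open>
  A rooting of a tree is given by a parent function and a depth function. The axioms are split: those
  of \<open>parent_structure\<close> hold for every breadth-first spanning tree of a connected graph;
  those of \<open>rooted_tree\<close> add that every edge joins a vertex to its parent.
\<close>

locale parent_structure =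
  fixes V :: "'v set" and A :: "('v \<times> 'v) set" and r :: 'v
    and par :: "'v \<Rightarrow> 'v" and dep :: "'v \<Rightarrow> nat"
  assumes root_in: "r \<in> V"
    and dep_root: "dep r = 0"
    and par_in: "z \<in> V \<Longrightarrow> z \<noteq> r \<Longrightarrow> par z \<in> V"
    and adj_par: "z \<in> V \<Longrightarrow> z \<noteq> r \<Longrightarrow> adj A (par z) z"
    and dep_par: "z \<in> V \<Longrightarrow> z \<noteq> r \<Longrightarrow> dep z = Suc (dep (par z))"
begin

definition anc :: "nat \<Rightarrow> 'v \<Rightarrow> 'v" where
  "anc j z = (par ^^ j) z"

lemma anc_0 [simp]: "anc 0 z = z" and anc_Suc: "anc (Suc j) z = par (anc j z)"
  by (simp_all add: anc_def)

lemma anc_Suc': "anc (Suc j) z = anc j (par z)"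
  by (simp add: anc_def funpow_swap1)

lemma anc_add: "anc i (anc j z) = anc (i + j) z"
  by (simp add: anc_def funpow_add)

lemma dep_pos: "z \<in> V \<Longrightarrow> 0 < dep z \<longleftrightarrow> z \<noteq> r"
  using dep_par dep_root by (cases "z = r") auto

lemma anc_in: "z \<in> V \<Longrightarrow> j \<le> dep z \<Longrightarrow> anc j z \<in> V \<and> dep (anc j z) = dep z - j"
proof (induction j)
  case (Suc j)
  then have IH: "anc j z \<in> V" "dep (anc j z) = dep z - j" by auto
  with Suc.prems have "anc j z \<noteq> r" using dep_pos by fastforce
  with IH show ?case using par_in[of "anc j z"] dep_par[of "anc j z"] by (simp add: anc_Suc)
qed simp

lemma dep_anc: "z \<in> V \<Longrightarrow> j \<le> dep z \<Longrightarrow> dep (anc j z) = dep z - j"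
  using anc_in by blast

lemma anc_dep: "z \<in> V \<Longrightarrow> anc (dep z) z = r"
  using anc_in[of z "dep z"] dep_pos by fastforce

text \<open>
  Following parents does not backtrack, because the depth decreases at every step.
\<close>

lemma ancestor_walk_up:
  assumes "z \<in> V" "m \<le> dep z"
  shows "nb_walk (adj A) m (\<lambda>t. anc t z)"
  unfolding nb_walk_def
proof (intro conjI allI impI)
  fix t assume t: "t < m"
  have *: "anc t z \<in> V" "dep (anc t z) = dep z - t" using anc_in assms t by auto
  then have "anc t z \<noteq> r" using assms t dep_root by auto
  then show "adj A (anc t z) (anc (Suc t) z)" using adj_par * adj_sym[of A "anc t z"] by (simp add: anc_Suc)
next
  fix t assume t: "Suc (Suc t) \<le> m"
  have "dep (anc t z) = dep z - t" "dep (anc (Suc (Suc t)) z) = dep z - Suc (Suc t)"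
    using assms t by (simp_all add: dep_anc)
  moreover have "dep z - t \<noteq> dep z - Suc (Suc t)" using assms t by linarith
  ultimately show "anc t z \<noteq> anc (Suc (Suc t)) z" by metis
qed

lemma ancestor_walk:
  "z \<in> V \<Longrightarrow> m \<le> dep z \<Longrightarrow> nb_walk (adj A) m (\<lambda>t. anc (m - t) z)"
  using nb_walk_rev[OF symp_adj ancestor_walk_up] by simp

end

locale rooted_tree = parent_structure V A r par dep
  for V :: "'v set" and A r par dep +
  assumes finite_V: "finite V"
    and arcs_in: "A \<subseteq> V \<times> V"
    and antisym_arcs: "(u, v) \<in> A \<Longrightarrow> (v, u) \<notin> A"
    and adj_cases: "adj A u v \<Longrightarrow> v \<noteq> r \<and> par v = u \<or> u \<noteq> r \<and> par u = v"
begin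

definition desc :: "'v \<Rightarrow> 'v set" where
  "desc a = {z \<in> V. dep a \<le> dep z \<and> anc (dep z - dep a) z = a}"

definition children :: "'v \<Rightarrow> 'v set" where
  "children u = {z \<in> V. z \<noteq> r \<and> par z = u}"

lemma adj_in: "adj A u v \<Longrightarrow> u \<in> V \<and> v \<in> V"
  using arcs_in by (auto simp: adj_def)

lemma desc_self: "a \<in> V \<Longrightarrow> a \<in> desc a"
  by (simp add: desc_def)

lemma desc_child: "z \<in> V \<Longrightarrow> z \<noteq> r \<Longrightarrow> par z \<in> desc a \<Longrightarrow> z \<in> desc a"
  using dep_par[of z] by (auto simp: desc_def Suc_diff_le anc_Suc')

lemma desc_trans: "z \<in> desc b \<Longrightarrow> b \<in> desc a \<Longrightarrow> z \<in> desc a"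
proof -
  assume z: "z \<in> desc b" and b: "b \<in> desc a"
  then have "anc (dep b - dep a) (anc (dep z - dep b) z) = a" by (simp add: desc_def)
  moreover have "dep b - dep a + (dep z - dep b) = dep z - dep a"
    using z b by (simp add: desc_def)
  ultimately show ?thesis using z b by (simp add: desc_def anc_add)
qed

lemma card_V_le: "card V \<le> Suc (card A)"
proof -
  \<comment> \<open>Every vertex but the root is assigned the arc joining it to its parent.\<close>
  define e where "e z = (if (par z, z) \<in> A then (par z, z) else (z, par z))" for z
  have fin: "finite A" using arcs_in finite_V by (meson finite_SigmaI finite_subset)
  have "e ` (V - {r}) \<subseteq> A" using adj_par by (auto simp: e_def adj_def)
  moreover have "inj_on e (V - {r})"
  proof (rule inj_onI)
    fix x y assume xy: "x \<in> V - {r}" "y \<in> V - {r}" "e x = e y"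
    then have "x = y \<or> x = par y \<and> y = par x" by (auto simp: e_def split: if_splits)
    with xy dep_par[of x] dep_par[of y] show "x = y" by auto
  qed
  ultimately have "card (V - {r}) \<le> card A" using fin by (meson card_inj_on_le)
  with finite_V root_in show ?thesis by (simp add: card_Diff_singleton)
qed

lemma dep_less_card: "z \<in> V \<Longrightarrow> dep z < card V"
proof -
  assume z: "z \<in> V"
  have "inj_on (\<lambda>j. anc j z) {..dep z}"
  proof (rule inj_onI)
    fix i j assume "i \<in> {..dep z}" "j \<in> {..dep z}" "anc i z = anc j z"
    then show "i = j" using anc_in[OF z, of i] anc_in[OF z, of j] by auto
  qed
  moreover have "(\<lambda>j. anc j z) ` {..dep z} \<subseteq> V" using anc_in[OF z] by auto
  ultimately have "card {..dep z} \<le> card V" using finite_V by (intro card_inj_on_le)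
  then show ?thesis by simp
qed

lemma neighbours_eq: "u \<in> V \<Longrightarrow> {v. adj A u v} = (if u = r then {} else {par u}) \<union> children u"
  using adj_cases[of u] adj_par adj_sym[of A] adj_in by (auto simp: children_def)

lemma finite_neighbours: "finite {v. adj A u v}"
  using finite_V adj_in by (auto intro: finite_subset[of _ V])

lemma par_notin_children: "u \<in> V \<Longrightarrow> u \<noteq> r \<Longrightarrow> par u \<notin> children u"
  using dep_par[of u] dep_par[of "par u"] by (auto simp: children_def)

lemma card_neighbours:
  "u \<in> V \<Longrightarrow> u \<noteq> r \<Longrightarrow> card {v. adj A u v} = Suc (card (children u))"
  using par_notin_children[of u] finite_V by (simp add: neighbours_eq children_def)

end


section \<open>Local embeddings\<close>

text \<open>
  The host \<open>(VD, AD)\<close> may be infinite; as \<^const>\<open>card\<close> is zero on infinite sets, for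
  \<open>d > 0\<close> the degree bounds also force all in-degrees and out-degrees to be finite.
\<close>

locale tree_and_host = rooted_tree V A r par dep
  for V :: "'v set" and A r par dep +
  fixes VD :: "'h set" and AD :: "('h \<times> 'h) set" and d :: nat
  assumes host_arcs: "AD \<subseteq> VD \<times> VD"
    and out_deg: "x \<in> VD \<Longrightarrow> d \<le> card {y. (x, y) \<in> AD}"
    and in_deg: "x \<in> VD \<Longrightarrow> d \<le> card {y. (y, x) \<in> AD}"
    and tree_deg: "u \<in> V \<Longrightarrow> card {v. adj A u v} \<le> d"
begin

definition local_embedding :: "'v set \<Rightarrow> ('v \<Rightarrow> 'h) \<Rightarrow> bool" where
  "local_embedding X g \<longleftrightarrow>
     (\<forall>u\<in>X. g u \<in> VD) \<and> (\<forall>u\<in>X. \<forall>v\<in>X. (u, v) \<in> A \<longrightarrow> (g u, g v) \<in> AD) \<and>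
     (\<forall>u\<in>X. inj_on g {v \<in> X. adj A u v})"

definition embedding :: "'v set \<Rightarrow> ('v \<Rightarrow> 'h) \<Rightarrow> bool" where
  "embedding X g \<longleftrightarrow>
     inj_on g X \<and> (\<forall>u\<in>X. g u \<in> VD) \<and> (\<forall>u\<in>X. \<forall>v\<in>X. (u, v) \<in> A \<longrightarrow> (g u, g v) \<in> AD)"

text \<open>
  The admissible images of \<open>z\<close> if its neighbour \<open>u\<close> is mapped to \<open>x\<close>.
\<close>

definition slots :: "'v \<Rightarrow> 'v \<Rightarrow> 'h \<Rightarrow> 'h set" where
  "slots u z x = (if (u, z) \<in> A then {y. (x, y) \<in> AD} else {y. (y, x) \<in> AD})"

lemma embedding_imp_local: "embedding X g \<Longrightarrow> local_embedding X g"
  by (auto simp: embedding_def local_embedding_def intro: inj_on_subset)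

lemma local_embedding_mono: "local_embedding X g \<Longrightarrow> X' \<subseteq> X \<Longrightarrow> local_embedding X' g"
  unfolding local_embedding_def by (blast intro: inj_on_subset)

lemma local_embedding_inj: "local_embedding V g \<Longrightarrow> inj_on g V \<Longrightarrow> embedding V g"
  by (auto simp: embedding_def local_embedding_def)

lemma local_embeddingD:
  assumes "local_embedding V g" "adj A u v" "adj A u v'" "g v = g v'"
  shows "v = v'"
  using assms adj_in unfolding local_embedding_def inj_on_def by blast

lemma card_slots: "x \<in> VD \<Longrightarrow> d \<le> card (slots u z x)"
  using out_deg in_deg by (simp add: slots_def)

lemma no_loop: "\<not> adj A u u"
  using adj_cases[of u u] dep_par[of u] adj_in[of u u] by auto

text \<open>
  As \<open>z\<close> has no child in \<open>X\<close>, its parent is its only neighbour there, so injectivity has to be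
  checked only around the parent.
\<close>

lemma local_embedding_attach:
  assumes X: "X \<subseteq> V" "local_embedding X g"
    and z: "z \<in> V" "z \<noteq> r" "par z \<in> X" "children z \<inter> X = {}" "z \<notin> X"
    and y: "y \<in> slots (par z) z (g (par z))" "y \<notin> g ` {v \<in> X. adj A (par z) v}"
  shows "local_embedding (insert z X) (g(z := y))"
proof -
  have nb: "v = par z" if "v \<in> insert z X" "adj A z v" for v
  proof -
    have "v \<noteq> z" using that(2) no_loop by metis
    then have "v \<in> X" using that(1) by simp
    then have "\<not> (v \<noteq> r \<and> par v = z)" using X(1) z(4) by (auto simp: children_def)
    with adj_cases[OF that(2)] show ?thesis by blast
  qed
  have nb': "adj A z v \<longleftrightarrow> v = par z" if "v \<in> X" for v
    using that nb[of v] adj_par[OF z(1,2)] adj_sym[of A "par z" z] by auto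
  have arc: "(par z, z) \<in> A \<longrightarrow> (g (par z), y) \<in> AD" "(z, par z) \<in> A \<longrightarrow> (y, g (par z)) \<in> AD"
    using y(1) antisym_arcs by (auto simp: slots_def split: if_splits)
  have pz: "par z \<noteq> z" using z by auto
  have "y \<in> VD" using y(1) host_arcs by (auto simp: slots_def split: if_splits)
  moreover have "(if u = z then y else g u, if v = z then y else g v) \<in> AD"
    if "u \<in> insert z X" "v \<in> insert z X" "(u, v) \<in> A" for u v
  proof -
    consider "u = z" | "v = z" | "u \<noteq> z" "v \<noteq> z" by blast
    then show ?thesis
    proof cases
      case 1
      with that nb[of v] have "v = par z" by (auto simp: adj_def)
      with 1 arc pz that show ?thesis by auto
    next
      case 2
      with that nb[of u] have "u = par z" by (auto simp: adj_def)
      with 2 arc pz that show ?thesis by auto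
    next
      case 3
      with that X(2) show ?thesis by (auto simp: local_embedding_def)
    qed
  qed
  moreover have "inj_on (g(z := y)) {v \<in> insert z X. adj A u v}" if "u \<in> insert z X" for u
  proof (cases "u = z")
    case True
    then have "{v \<in> insert z X. adj A u v} \<subseteq> {par z}" using nb by auto
    then show ?thesis by (rule inj_on_subset[rotated]) simp
  next
    case False
    with that have u: "u \<in> X" by simp
    then have inj: "inj_on g {v \<in> X. adj A u v}" using X(2) by (simp add: local_embedding_def)
    show ?thesis
    proof (rule inj_onI)
      fix v v' assume *: "v \<in> {v \<in> insert z X. adj A u v}" "v' \<in> {v \<in> insert z X. adj A u v}"
        "(g(z := y)) v = (g(z := y)) v'"
      have "u = par z" if "adj A u z" using that nb'[OF u] adj_sym[of A u z] by simp
      with * z(5) y(2) inj show "v = v'"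
        by (auto simp: inj_on_def split: if_splits)
    qed
  qed
  ultimately show ?thesis using X(2) by (auto simp: local_embedding_def)
qed

text \<open>
  Greedy extension from a set closed under taking parents. At most \<open>d - 1\<close> neighbours of the
  parent of the next vertex already have an image, and the image of the parent has \<open>d\<close> neighbours
  in the required direction. Other vertices may share the new image: injectivity is only local.
\<close>

lemma local_embedding_extend:
  assumes "X \<subseteq> V" "r \<in> X" "\<And>z. z \<in> X \<Longrightarrow> z \<noteq> r \<Longrightarrow> par z \<in> X" "local_embedding X g"
  shows "\<exists>g'. local_embedding V g' \<and> (\<forall>x\<in>X. g' x = g x)"
  using assms
proof (induction "card (V - X)" arbitrary: X g)
  case 0
  then have "X = V" using finite_V by auto
  with 0 show ?case by blast
next
  case (Suc n)
  then have "\<exists>z. z \<in> V - X" by (metis card.empty ex_in_conv nat.distinct(1))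
  \<comment> \<open>A missing vertex of least depth has its parent in X.\<close>
  then obtain z where z: "z \<in> V - X" "\<And>z'. z' \<in> V - X \<Longrightarrow> dep z \<le> dep z'"
    using arg_min_nat_lemma[of "\<lambda>z. z \<in> V - X" _ dep] by blast
  then have zr: "z \<noteq> r" using Suc.prems by auto
  have "dep (par z) < dep z" using dep_par z zr by auto
  then have pX: "par z \<in> X" using z par_in zr by force
  have ch: "children z \<inter> X = {}" using Suc.prems(3) z by (auto simp: children_def)
  define N where "N = {v \<in> X. adj A (par z) v}"
  have "N \<subset> {v. adj A (par z) v}" using z adj_par zr by (auto simp: N_def)
  then have "card N < card {v. adj A (par z) v}" using finite_neighbours by (rule psubset_card_mono[rotated])
  then have "card N < d" using tree_deg pX Suc.prems(1) by (meson in_mono order_less_le_trans)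
  moreover have finN: "finite N" using \<open>N \<subset> _\<close> finite_neighbours by (metis finite_subset psubsetE)
  ultimately have "card (g ` N) < d" by (meson card_image_le le_less_trans)
  moreover have "d \<le> card (slots (par z) z (g (par z)))"
    using pX Suc.prems(4) by (intro card_slots) (auto simp: local_embedding_def)
  ultimately have "\<not> slots (par z) z (g (par z)) \<subseteq> g ` N"
    using card_mono[of "g ` N" "slots (par z) z (g (par z))"] finN by auto
  then obtain y where "y \<in> slots (par z) z (g (par z))" "y \<notin> g ` N" by blast
  then have step: "local_embedding (insert z X) (g(z := y))"
    using Suc.prems z zr pX ch by (intro local_embedding_attach) (auto simp: N_def)
  have n: "n = card (V - insert z X)"
  proof -
    have "V - insert z X = (V - X) - {z}" by auto
    then show ?thesis using Suc.hyps(2) z by (simp add: card_Diff_singleton)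
  qed
  have closed: "insert z X \<subseteq> V" "r \<in> insert z X"
    "\<And>x. x \<in> insert z X \<Longrightarrow> x \<noteq> r \<Longrightarrow> par x \<in> insert z X"
    using Suc.prems(1-3) z pX by auto
  from Suc.hyps(1)[OF n closed step] obtain g' where
    g': "local_embedding V g'" "\<forall>x\<in>insert z X. g' x = (g(z := y)) x"
    by blast
  have "g' x = g x" if "x \<in> X" for x
  proof -
    have "x \<noteq> z" using that z by auto
    then show ?thesis using g'(2) that by simp
  qed
  with g'(1) show ?case by (intro exI[of _ g'] conjI ballI)
qed

text \<open>
  The two neighbours of an inner vertex of the walk are distinct and hence have distinct images.
\<close>

lemma local_embedding_walk:
  assumes "local_embedding V g" "nb_walk (adj A) m P"
  shows "nb_walk (adj AD) m (\<lambda>t. g (P t))"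
proof -
  have "adj AD (g u) (g v)" if "adj A u v" for u v
    using that assms(1) adj_in[OF that] by (auto simp: local_embedding_def adj_def)
  moreover have "g (P t) \<noteq> g (P (Suc (Suc t)))" if "Suc (Suc t) \<le> m" for t
  proof
    assume eq: "g (P t) = g (P (Suc (Suc t)))"
    have "adj A (P t) (P (Suc t))" "adj A (P (Suc t)) (P (Suc (Suc t)))"
      using assms(2) that by (auto simp: nb_walk_def)
    then have "P t = P (Suc (Suc t))" using local_embeddingD[OF assms(1)] eq adj_sym by metis
    with assms(2) that show False by (auto simp: nb_walk_def)
  qed
  ultimately show ?thesis using assms(2) by (auto simp: nb_walk_def)
qed

lemma local_embedding_exists:
  assumes "VD \<noteq> {}"
  shows "\<exists>g. local_embedding V g"
proof -
  obtain x where x: "x \<in> VD" using assms by blast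
  have "(r, r) \<notin> A" using no_loop[of r] by (simp add: adj_def)
  moreover have "inj_on (\<lambda>_. x) {v \<in> {r}. adj A r v}" by (auto simp: inj_on_def)
  ultimately have g: "local_embedding {r} (\<lambda>_. x)" using x by (simp add: local_embedding_def)
  from local_embedding_extend[OF _ _ _ g] root_in show ?thesis by auto
qed

end

section \<open>Completing an embedding that misses one deepest leaf\<close>

text \<open>
  The situation that the induction step has to refute: \<open>T - w\<close> has an embedding, \<open>T\<close> has none.
  It forces \<open>T\<close> to be large.
\<close>

locale stuck_embedding = tree_and_host V A r par dep VD AD d
  for V :: "'v set" and A r par dep and VD :: "'h set" and AD d +
  fixes l :: nat and w :: 'v and f :: "'v \<Rightarrow> 'h"
  assumes l_pos: "1 \<le> l"
    and w_in: "w \<in> V"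
    and deepest: "z \<in> V \<Longrightarrow> dep z \<le> dep w"
    and deep: "2 * l \<le> dep w"
    and host_girth: "girth_exceeds (adj AD) (2 * l)"
    and f_embedding: "embedding (V - {w}) f"
    and stuck: "\<not> embedding V g"
begin

definition a :: 'v where "a = anc l w"

text \<open>
  The edges to be rerouted join \<open>anc (Suc j) w\<close> to its child \<open>anc j w\<close> for \<open>j < l\<close>. The alternative
  images of the child avoid the present images of all neighbours of \<open>anc (Suc j) w\<close>,
  that of \<open>anc j w\<close> included if \<open>j > 0\<close>. Only \<open>w\<close> has no image, which is why it is left out; this
  is what makes one more alternative available for \<open>j = 0\<close>.
\<close>

definition alternatives :: "nat \<Rightarrow> 'h set" where
  "alternatives j = slots (anc (Suc j) w) (anc j w) (f (anc (Suc j) w))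
     - f ` ({v. adj A (anc (Suc j) w) v} - {w})"

text \<open>
  The vertex \<open>q\<close> obstructs the alternative \<open>y\<close>: its image under \<open>f\<close> is hit when the branch at
  \<open>anc j w\<close> is moved to \<open>y\<close>.
\<close>

definition collides :: "nat \<Rightarrow> 'h \<Rightarrow> 'v \<Rightarrow> bool" where
  "collides j y q \<longleftrightarrow> (\<exists>g p. local_embedding V g \<and> (\<forall>z \<in> V - desc (anc j w). g z = f z) \<and>
     g (anc j w) = y \<and> p \<in> desc (anc j w) \<and> q \<in> V - desc a \<and> g p = f q)"

lemma anc_w: "j \<le> 2 * l \<Longrightarrow> anc j w \<in> V \<and> dep (anc j w) = dep w - j"
  using anc_in w_in deep by simp

lemma anc_w_not_root: "j < 2 * l \<Longrightarrow> anc j w \<noteq> r"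
  using anc_w[of j] deep dep_root by auto

lemma a_in: "a \<in> V" and dep_a: "dep a = dep w - l"
  using anc_w[of l] by (auto simp: a_def)

lemma anc_w_desc: "i \<le> j \<Longrightarrow> j \<le> 2 * l \<Longrightarrow> anc i w \<in> desc (anc j w)"
  using anc_w[of i] anc_w[of j] deep by (simp add: desc_def anc_add)

lemma not_desc_anc: "i < j \<Longrightarrow> j \<le> 2 * l \<Longrightarrow> anc j w \<notin> desc (anc i w)"
  using anc_w[of i] anc_w[of j] deep by (auto simp: desc_def)

lemma below_a: "p \<in> desc a \<Longrightarrow> p \<in> V \<and> dep p - dep a \<le> l \<and> anc (dep p - dep a) p = a"
  using deepest[of p] dep_a deep by (auto simp: desc_def)

lemma walk_below_a:
  assumes "local_embedding V g" "p \<in> desc a"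
  shows "nb_walk (adj AD) (dep p - dep a) (\<lambda>t. g (anc (dep p - dep a - t) p))"
  using assms below_a[of p] by (intro local_embedding_walk ancestor_walk) auto

text \<open>
  No vertex lies more than \<open>l\<close> levels below \<open>a\<close>, so the images of two descents from \<open>a\<close> with the
  same end are the same walk; local injectivity then identifies the descents step by step.
\<close>

lemma injective_below_a:
  assumes g: "local_embedding V g" and pq: "p \<in> desc a" "q \<in> desc a" "g p = g q"
  shows "p = q"
proof -
  let ?m = "dep p - dep a" and ?n = "dep q - dep a"
  have "girth_exceeds (adj AD) (?m + ?n)"
    using host_girth below_a pq by (elim girth_exceeds_mono) (simp add: add_le_mono mult_2)
  then have *: "?m = ?n \<and> (\<forall>i\<le>?m. g (anc (?m - i) p) = g (anc (?n - i) q))"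
    using pq below_a by (intro nb_walk_unique[of "adj AD"] walk_below_a g)
      (auto intro: symp_adj)
  have "anc (?m - i) p = anc (?m - i) q" if "i \<le> ?m" for i
    using that
  proof (induction i)
    case 0
    then show ?case using pq below_a[of p] below_a[of q] * by simp
  next
    case (Suc i)
    have "adj A (anc (?m - i) p) (anc (?m - Suc i) p)"
      using ancestor_walk[of p ?m] below_a[OF pq(1)] Suc.prems unfolding nb_walk_def by auto
    moreover have "adj A (anc (?m - i) q) (anc (?m - Suc i) q)"
      using ancestor_walk[of q ?n] below_a[OF pq(2)] Suc.prems * unfolding nb_walk_def by auto
    moreover have "anc (?m - i) p = anc (?m - i) q" using Suc by simp
    moreover have "g (anc (?m - Suc i) p) = g (anc (?m - Suc i) q)" using * Suc.prems by metis
    ultimately show ?case using * local_embeddingD[OF g] by metis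
  qed
  from this[of ?m] show ?thesis by simp
qed

text \<open>
  Cut off the branch at \<open>anc j w\<close>, attach its top vertex at \<open>y\<close> and regrow the branch greedily.
  Since \<open>w\<close> belongs to the branch, the rest has images under \<open>f\<close>.
\<close>

lemma reroute:
  assumes j: "j < l" and y: "y \<in> alternatives j"
  shows "\<exists>g. local_embedding V g \<and> (\<forall>z \<in> V - desc (anc j w). g z = f z) \<and> g (anc j w) = y"
proof -
  let ?v = "anc j w" and ?u = "anc (Suc j) w"
  define X where "X = V - desc ?v"
  have v: "?v \<in> V" "dep ?v = dep w - j" "?v \<noteq> r" "par ?v = ?u"
    using anc_w[of j] j deep dep_root by (auto simp: anc_Suc)
  have wX: "w \<notin> X" using anc_w_desc[of 0 j] j by (simp add: X_def)
  have vX: "?v \<notin> X" using desc_self v by (simp add: X_def)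
  have uX: "?u \<in> X" using not_desc_anc[of j "Suc j"] anc_w[of "Suc j"] j by (simp add: X_def)
  have rX: "r \<in> X" using v j deep root_in dep_root by (auto simp: X_def desc_def)
  have pX: "par z \<in> X" if "z \<in> X" "z \<noteq> r" for z
    using that par_in desc_child by (auto simp: X_def)
  have "local_embedding X f"
    using wX by (intro local_embedding_mono[OF embedding_imp_local[OF f_embedding]]) (auto simp: X_def)
  moreover have "children ?v \<inter> X = {}"
    using desc_child desc_self v by (auto simp: children_def X_def)
  moreover have "y \<notin> f ` {z \<in> X. adj A (par ?v) z}"
    using y wX unfolding v by (auto simp: alternatives_def)
  ultimately have step: "local_embedding (insert ?v X) (f(?v := y))"
    using v vX uX y by (intro local_embedding_attach) (auto simp: alternatives_def X_def)
  have closed: "insert ?v X \<subseteq> V" "r \<in> insert ?v X"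
    "\<And>z. z \<in> insert ?v X \<Longrightarrow> z \<noteq> r \<Longrightarrow> par z \<in> insert ?v X"
    using v rX pX uX by (auto simp: X_def)
  from local_embedding_extend[OF closed step] obtain g where
    g: "local_embedding V g" "\<forall>x\<in>insert ?v X. g x = (f(?v := y)) x"
    by blast
  have "g z = f z" if "z \<in> V - desc ?v" for z
  proof -
    have "z \<in> X" "z \<noteq> ?v" using that vX by (auto simp: X_def)
    then show ?thesis using g(2) by simp
  qed
  with g show ?thesis by auto
qed

text \<open>
  The rerouted map is not injective, as \<open>T\<close> has no embedding. A coincidence cannot occur between
  two vertices outside the moved branch, where the map is \<open>f\<close>, nor between two vertices below
  \<open>a\<close>. So it occurs between the branch and a vertex that is not below \<open>a\<close>.
\<close>

lemma collision_exists:
  assumes j: "j < l" and y: "y \<in> alternatives j"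
  shows "\<exists>q. collides j y q"
proof -
  let ?v = "anc j w"
  obtain g where g: "local_embedding V g" "\<forall>z \<in> V - desc ?v. g z = f z" "g ?v = y"
    using reroute assms by blast
  have sub: "desc ?v \<subseteq> desc a"
    using anc_w_desc[of j l] j desc_trans by (auto simp: a_def)
  have "\<not> inj_on g V" using local_embedding_inj g stuck by blast
  then obtain p q where pq: "p \<in> V" "q \<in> V" "g p = g q" "p \<noteq> q" by (auto simp: inj_on_def)
  have "w \<in> desc ?v" using anc_w_desc[of 0 j] j by simp
  then have "p \<in> desc ?v \<or> q \<in> desc ?v"
  proof (rule_tac ccontr)
    assume "\<not> (p \<in> desc ?v \<or> q \<in> desc ?v)"
    moreover from this have "f p = f q" using g(2) pq by auto
    moreover have "inj_on f (V - {w})" using f_embedding by (simp add: embedding_def)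
    ultimately show False using pq \<open>w \<in> desc ?v\<close> by (metis Diff_iff inj_onD singletonD)
  qed
  moreover have "\<exists>q. collides j y q" if p: "p \<in> desc ?v" and q: "q \<in> V" "g p = g q" "p \<noteq> q" for p q
  proof -
    have "q \<notin> desc a" using injective_below_a[OF g(1)] p q sub by blast
    moreover from this have "g p = f q" using g(2) q sub by auto
    ultimately have "collides j y q"
      unfolding collides_def using g p q(1) by (intro exI[of _ g] exI[of _ p]) simp
    then show ?thesis ..
  qed
  ultimately show ?thesis using pq by metis
qed

text \<open>
  Both collisions give a non-backtracking walk of length at most \<open>l\<close> from \<open>f a\<close> to \<open>f q\<close>,
  so the two walks are equal. The first walk follows \<open>f\<close> down to \<open>anc (Suc j) w\<close> and then moves to
  \<open>y\<close>. If the second one was rerouted strictly lower down, its corresponding vertex would be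
  \<open>f (anc j w)\<close>, which is not an alternative.
\<close>

lemma collision_unique:
  assumes c: "collides j y q" "collides j' y' q" and y: "y \<in> alternatives j" and j: "j' \<le> j" "j < l"
  shows "j = j' \<and> y = y'"
proof -
  obtain g p where g: "local_embedding V g" "\<forall>z \<in> V - desc (anc j w). g z = f z"
    "g (anc j w) = y" "p \<in> desc (anc j w)" "g p = f q" using c(1) by (auto simp: collides_def)
  obtain g' p' where g': "local_embedding V g'" "\<forall>z \<in> V - desc (anc j' w). g' z = f z"
    "g' (anc j' w) = y'" "p' \<in> desc (anc j' w)" "g' p' = f q" using c(2) by (auto simp: collides_def)
  have pa: "p \<in> desc a" "p' \<in> desc a"
    using g(4) g'(4) j anc_w_desc[of _ l] desc_trans by (auto simp: a_def)
  let ?m = "dep p - dep a" and ?n = "dep p' - dep a"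
  have "a \<notin> desc (anc j w)" "a \<notin> desc (anc j' w)" using not_desc_anc j by (auto simp: a_def)
  then have ga: "g a = g' a" using g g' a_in by simp
  have "girth_exceeds (adj AD) (?m + ?n)"
    using host_girth below_a pa by (elim girth_exceeds_mono) (simp add: add_le_mono mult_2)
  then have *: "?m = ?n \<and> (\<forall>i\<le>?m. g (anc (?m - i) p) = g' (anc (?n - i) p'))"
    using pa below_a ga g(5) g'(5) by (intro nb_walk_unique[of "adj AD"] walk_below_a g(1) g'(1))
      (auto intro: symp_adj)
  \<comment> \<open>After l - j steps from a, the descent to a vertex below anc j w is at anc j w.\<close>
  have an: "anc (dep z - dep a - (l - j)) z = anc j w"
    if z: "z \<in> desc (anc i w)" and i: "i \<le> j" for z i
  proof -
    have "dep z - (dep w - i) + (j - i) = dep z - dep a - (l - j)"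
      using z i j deep anc_w[of i] dep_a by (auto simp: desc_def)
    moreover have "anc (j - i) (anc (dep z - (dep w - i)) z) = anc j w"
      using z i j anc_w[of i] by (simp add: desc_def anc_add)
    ultimately show ?thesis by (simp add: anc_add add.commute)
  qed
  have "l - j \<le> ?m" using g(4) anc_w[of j] j dep_a deep by (auto simp: desc_def)
  then have "g (anc (?m - (l - j)) p) = g' (anc (?n - (l - j)) p')" using * by blast
  then have eq: "y = g' (anc j w)" using an[OF g(4)] an[OF g'(4) j(1)] g(3) by simp
  show ?thesis
  proof (cases "j = j'")
    case True
    then show ?thesis using eq g'(3) by simp
  next
    case False
    with j have "j' < j" by simp
    then have "g' (anc j w) = f (anc j w)" using g'(2) not_desc_anc[of j' j] anc_w[of j] j by auto
    moreover have "adj A (anc (Suc j) w) (anc j w)"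
      using adj_par[of "anc j w"] anc_w[of j] anc_w_not_root[of j] j by (simp add: anc_Suc)
    moreover have "anc j w \<noteq> w"
    proof
      assume "anc j w = w"
      then have "dep w = dep w - j" using anc_w[of j] j by simp
      then show False using \<open>j' < j\<close> j deep by linarith
    qed
    ultimately show ?thesis using y eq by (auto simp: alternatives_def)
  qed
qed

text \<open>
  Otherwise the path going down from \<open>anc i a\<close> to the colliding vertex of the moved branch, of length
  at most \<open>i + l \<le> 2 l\<close>, would be mapped to a closed walk.
\<close>

lemma collision_far:
  assumes c: "collides j y q" and i: "i \<in> {1..l}" and j: "j < l"
  shows "q \<noteq> anc i a"
proof
  assume q: "q = anc i a"
  obtain g p where g: "local_embedding V g" "\<forall>z \<in> V - desc (anc j w). g z = f z"
    "p \<in> desc (anc j w)" "q \<in> V - desc a" "g p = f q" using c by (auto simp: collides_def)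
  have sub: "desc (anc j w) \<subseteq> desc a" using anc_w_desc[of j l] j desc_trans by (auto simp: a_def)
  then have gq: "g q = f q" and pa: "p \<in> desc a" using g by auto
  let ?m = "dep p - dep a"
  have "i + ?m \<le> dep p" using i below_a[OF pa] dep_a deep pa by (auto simp: desc_def)
  then have "nb_walk (adj AD) (i + ?m) (\<lambda>t. g (anc (i + ?m - t) p))"
    using below_a[OF pa] g(1) by (intro local_embedding_walk ancestor_walk) auto
  then have "g (anc (i + ?m - 0) p) \<noteq> g (anc (i + ?m - (i + ?m)) p)"
    using below_a[OF pa] i by (intro nb_walk_neq[OF host_girth]) auto
  then have "g (anc (i + ?m) p) \<noteq> g p" by simp
  moreover have "anc (i + ?m) p = q" using below_a[OF pa] q by (simp flip: anc_add)
  ultimately show False using gq g(5) by simp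
qed

text \<open>
  The final count: \<open>C\<close> consists of the children of the vertices \<open>anc (Suc j) w\<close> and, like \<open>a\<close>, lies
  below \<open>a\<close> (where \<open>a\<close> counts as below itself); the obstructions \<open>H\<close> and the \<open>l\<close> nearest ancestors
  \<open>B\<close> of \<open>a\<close> do not.
\<close>

lemma too_many_vertices: "l * d + 1 < card V"
proof -
  let ?u = "\<lambda>j. anc (Suc j) w"
  have "\<forall>j y. \<exists>q. j < l \<longrightarrow> y \<in> alternatives j \<longrightarrow> collides j y q"
    using collision_exists by blast
  then obtain h where h: "\<And>j y. j < l \<Longrightarrow> y \<in> alternatives j \<Longrightarrow> collides j y (h j y)"
    by metis
  define H where "H = (\<lambda>(j, y). h j y) ` (SIGMA j:{..<l}. alternatives j)"
  define B where "B = (\<lambda>i. anc i a) ` {1..l}"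
  define C where "C = (\<Union>j<l. children (?u j))"
  have u: "?u j \<in> V" "?u j \<noteq> r" "dep (?u j) = dep w - Suc j" if "j < l" for j
    using anc_w[of "Suc j"] that deep dep_root by auto
  have inj: "inj_on (\<lambda>(j, y). h j y) (SIGMA j:{..<l}. alternatives j)"
  proof (rule inj_onI)
    fix s t assume st: "s \<in> (SIGMA j:{..<l}. alternatives j)" "t \<in> (SIGMA j:{..<l}. alternatives j)"
      "(case s of (j, y) \<Rightarrow> h j y) = (case t of (j, y) \<Rightarrow> h j y)"
    obtain j y j' y' where s: "s = (j, y)" and t: "t = (j', y')" by fastforce
    have "collides j y (h j y)" "collides j' y' (h j' y')"
      using h[of j y] h[of j' y'] st(1,2) s t by auto
    moreover have "h j y = h j' y'" using st(3) s t by simp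
    ultimately have c: "collides j y (h j y)" "collides j' y' (h j y)" by simp_all
    show "s = t"
    proof (cases "j' \<le> j")
      case True
      then show ?thesis using collision_unique[OF c] st s t by auto
    next
      case False
      then show ?thesis using collision_unique[OF c(2,1)] st s t by auto
    qed
  qed
  have HV: "H \<subseteq> V - desc a" using h by (auto simp: H_def collides_def)
  have finH: "finite H" using HV finite_V by (meson finite_Diff finite_subset)
  have fin_alt: "finite (alternatives j)" if "j < l" for j
  proof -
    have "finite (SIGMA j:{..<l}. alternatives j)" using finH inj unfolding H_def by (rule finite_imageD)
    then have "finite (snd ` ((SIGMA j:{..<l}. alternatives j) \<inter> {j} \<times> UNIV))" by blast
    then show ?thesis by (rule finite_subset[rotated]) (use that in force)
  qed
  have cardH: "card H = (\<Sum>j<l. card (alternatives j))"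
    unfolding H_def using fin_alt inj by (simp add: card_image)
  have ia: "anc i a \<in> V" "dep (anc i a) = dep a - i" "i \<le> dep a" if "i \<in> {1..l}" for i
    using that anc_in[OF a_in, of i] dep_a deep by auto
  have BV: "B \<subseteq> V - desc a" using ia by (force simp: B_def desc_def)
  have "inj_on (\<lambda>i. anc i a) {1..l}"
    by (rule inj_onI) (metis ia(2,3) diff_diff_cancel)
  then have cardB: "card B = l" by (simp add: B_def card_image)
  have HB: "H \<inter> B = {}" using collision_far h by (fastforce simp: H_def B_def)
  have dep_child: "dep z = dep w - j" if "j < l" "z \<in> children (?u j)" for j z
    using that u[of j] dep_par[of z] deep by (auto simp: children_def)
  have finC: "finite (children v)" for v using finite_V by (simp add: children_def)
  have cardC: "card C = (\<Sum>j<l. card (children (?u j)))"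
    unfolding C_def
  proof (rule card_UN_disjoint)
    show "\<forall>i\<in>{..<l}. \<forall>j\<in>{..<l}. i \<noteq> j \<longrightarrow> children (?u i) \<inter> children (?u j) = {}"
    proof (intro ballI impI)
      fix i j assume "i \<in> {..<l}" "j \<in> {..<l}" "i \<noteq> j"
      then show "children (?u i) \<inter> children (?u j) = {}"
        using dep_child[of i] dep_child[of j] deep by fastforce
    qed
  qed (use finC in auto)
  have CV: "C \<subseteq> desc a"
  proof -
    have "?u j \<in> desc a" if "j < l" for j using anc_w_desc[of "Suc j" l] that by (simp add: a_def)
    then show ?thesis using desc_child by (auto simp: C_def children_def)
  qed
  have aC: "a \<notin> C"
  proof
    assume "a \<in> C"
    then obtain j where "j < l" "a \<in> children (?u j)" by (auto simp: C_def)
    then show False using dep_child[of j a] dep_a deep by auto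
  qed
  have "card (insert a C \<union> (H \<union> B)) = Suc (card C) + (card H + card B)"
    using CV HV BV HB aC finH a_in desc_self finite_V finC
    by (subst card_Un_disjoint) (auto simp: card_Un_disjoint C_def B_def)
  moreover have "card (insert a C \<union> (H \<union> B)) \<le> card V"
    using CV HV BV a_in finite_V by (intro card_mono) (auto simp: desc_def)
  ultimately have total: "Suc (card C) + (card H + l) \<le> card V" using cardB by simp
  let ?s = "\<lambda>j. card (alternatives j) + card (children (?u j)) + 1"
  have alt: "d \<le> card (alternatives j) + card ({v. adj A (?u j) v} - {w})" if "j < l" for j
  proof -
    let ?N = "{v. adj A (?u j) v} - {w}"
    have "?u j \<noteq> w" using u[OF that] deep that by force
    then have "f (?u j) \<in> VD" using u[OF that] f_embedding by (simp add: embedding_def)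
    then have "d \<le> card (slots (?u j) (anc j w) (f (?u j)))" by (rule card_slots)
    also have "\<dots> \<le> card (alternatives j) + card (f ` ?N)"
      unfolding alternatives_def using diff_card_le_card_Diff[of "f ` ?N"] finite_neighbours
      by (metis add.commute finite_Diff finite_imageI le_diff_conv)
    also have "card (f ` ?N) \<le> card ?N" using finite_neighbours by (simp add: card_image_le)
    finally show ?thesis by simp
  qed
  \<comment> \<open>The additional 1 in s stands for the parent of anc (Suc j) w, the neighbour that is not a child.\<close>
  have s: "d \<le> ?s j" if "j < l" for j
  proof -
    have "card ({v. adj A (?u j) v} - {w}) \<le> card {v. adj A (?u j) v}"
      using finite_neighbours by (simp add: card_Diff1_le)
    with alt[OF that] card_neighbours[OF u(1,2)] that show ?thesis by fastforce
  qed
  obtain l' where l': "l = Suc l'" using l_pos by (cases l) auto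
  have s0: "d + 1 \<le> ?s 0"
  proof -
    have "w \<noteq> r" using dep_root deep l' by auto
    then have "adj A (?u 0) w" using adj_par[of w] w_in by (simp add: anc_Suc)
    then have "card ({v. adj A (?u 0) v} - {w}) = card (children (?u 0))"
      using card_neighbours[OF u(1,2), of 0] finite_neighbours l' by (simp add: card_Diff_singleton)
    with alt[of 0] l' show ?thesis by simp
  qed
  have "(d + 1) + (\<Sum>j<l'. d) \<le> ?s 0 + (\<Sum>j<l'. ?s (Suc j))"
    by (intro add_mono sum_mono s0 s) (simp add: l')
  also have "\<dots> = (\<Sum>j<l. ?s j)" by (simp only: l' sum.lessThan_Suc_shift)
  also have "\<dots> = card H + card C + l" by (simp only: sum.distrib cardH cardC) simp
  finally have "l * d + 1 \<le> card H + card C + l" by (simp add: l')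
  with total show ?thesis by simp
qed

end


section \<open>Embedding abstract trees\<close>

text \<open>
  A tree that can be rooted at each of its vertices. The freedom in the root is what
  makes a deepest vertex the end of a longest path.
\<close>

definition oriented_tree_on :: "'v set \<Rightarrow> ('v \<times> 'v) set \<Rightarrow> bool" where
  "oriented_tree_on V A \<longleftrightarrow> V \<noteq> {} \<and> (\<forall>r\<in>V. \<exists>par dep. rooted_tree V A r par dep)"

lemma oriented_tree_onE:
  assumes "oriented_tree_on V A" "r \<in> V"
  obtains par dep where "rooted_tree V A r par dep"
  using assms unfolding oriented_tree_on_def by blast

text \<open>
  The only neighbour of the removed vertex is its parent, so in a rooting at another vertex it has
  no children either and all other parents remain.
\<close>

lemma (in rooted_tree) oriented_tree_on_remove_leaf:
  assumes tree: "oriented_tree_on V A" and w: "w \<in> V" "w \<noteq> r"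
    and leaf: "children w = {}"
  shows "oriented_tree_on (V - {w}) (A \<inter> (V - {w}) \<times> (V - {w}))"
  unfolding oriented_tree_on_def
proof (intro conjI ballI)
  show "V - {w} \<noteq> {}" using w root_in by blast
next
  fix s assume s: "s \<in> V - {w}"
  then have "s \<in> V" by simp
  with tree obtain par' dep' where "rooted_tree V A s par' dep'" by (rule oriented_tree_onE)
  then interpret S: rooted_tree V A s par' dep' .
  have only: "v = par w" if "adj A w v" for v
    using that adj_cases[OF that] adj_in[OF that] leaf by (auto simp: children_def)
  have par': "par' z \<noteq> w" if "z \<in> V - {w}" "z \<noteq> s" for z
  proof
    assume eq: "par' z = w"
    then have "z = par w" using S.adj_par[of z] that only by auto
    moreover have "par' w = par w"
      using S.adj_par[of w] adj_sym[of A w] only[of "par' w"] w s by blast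
    ultimately have "par' w = z" by simp
    with eq have "dep' z = Suc (Suc (dep' z))" using S.dep_par[of z] S.dep_par[of w] that w s by auto
    then show False by simp
  qed
  let ?A = "A \<inter> (V - {w}) \<times> (V - {w})"
  have "rooted_tree (V - {w}) ?A s par' dep'"
  proof
    show "s \<in> V - {w}" using s .
    show "dep' s = 0" by (rule S.dep_root)
    show "finite (V - {w})" using finite_V by simp
    show "?A \<subseteq> (V - {w}) \<times> (V - {w})" by blast
    fix u v assume "(u, v) \<in> ?A"
    then show "(v, u) \<notin> ?A" using antisym_arcs by blast
  next
    fix z assume z: "z \<in> V - {w}" "z \<noteq> s"
    then show "par' z \<in> V - {w}" using S.par_in par' by blast
    with z show "adj ?A (par' z) z" using S.adj_par[of z] by (auto simp: adj_def)
    show "dep' z = Suc (dep' (par' z))" using z S.dep_par by blast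
  next
    fix u v assume "adj ?A u v"
    then have "adj A u v" by (auto simp: adj_def)
    then show "v \<noteq> s \<and> par' v = u \<or> u \<noteq> s \<and> par' u = v" by (rule S.adj_cases)
  qed
  then show "\<exists>par dep. rooted_tree (V - {w}) ?A s par dep" by blast
qed

lemma oriented_tree_on_embeds:
  fixes V :: "'v set" and AD :: "('h \<times> 'h) set"
  assumes "oriented_tree_on V A"
    and "\<And>u. u \<in> V \<Longrightarrow> card {v. adj A u v} \<le> d"
    and "card V \<le> l * d + 1" and l: "1 \<le> l"
    and host: "VD \<noteq> {}" "AD \<subseteq> VD \<times> VD"
      "\<And>x. x \<in> VD \<Longrightarrow> d \<le> card {y. (x, y) \<in> AD}"
      "\<And>x. x \<in> VD \<Longrightarrow> d \<le> card {y. (y, x) \<in> AD}"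
    and girth: "girth_exceeds (adj AD) (2 * l)"
  shows "\<exists>g. inj_on g V \<and> (\<forall>u\<in>V. g u \<in> VD) \<and> (\<forall>u\<in>V. \<forall>v\<in>V. (u, v) \<in> A \<longrightarrow> (g u, g v) \<in> AD)"
  using assms(1-3)
proof (induction "card V" arbitrary: V A)
  case 0
  then obtain r where r: "r \<in> V" by (auto simp: oriented_tree_on_def)
  with 0(2) obtain par dep where "rooted_tree V A r par dep" by (rule oriented_tree_onE)
  then have "finite V" by (rule rooted_tree.finite_V)
  with 0 r show ?case by simp
next
  case (Suc n)
  \<comment> \<open>The depths that occur in any rooting: the largest is the length of a longest path.\<close>
  define height where "height = (\<lambda>L. \<exists>r par dep w. rooted_tree V A r par dep \<and> w \<in> V \<and> dep w = L)"
  obtain r0 where r0: "r0 \<in> V" using Suc.prems(1) by (auto simp: oriented_tree_on_def)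
  with Suc.prems(1) obtain par0 dep0 where "rooted_tree V A r0 par0 dep0" by (rule oriented_tree_onE)
  with r0 have "height (dep0 r0)" unfolding height_def by blast
  have bound: "L \<le> card V" if "height L" for L
    using that rooted_tree.dep_less_card less_imp_le unfolding height_def by metis
  define L where "L = Greatest height"
  have L: "height L"
    unfolding L_def using \<open>height (dep0 r0)\<close> bound by (rule GreatestI_nat)
  have L_max: "L' \<le> L" if "height L'" for L'
    unfolding L_def using that bound by (rule Greatest_le_nat)
  from L obtain r par dep w where rt: "rooted_tree V A r par dep" and w: "w \<in> V" "dep w = L"
    unfolding height_def by blast
  have th: "tree_and_host V A r' par' dep' VD AD d" if "rooted_tree V A r' par' dep'" for r' par' dep'
    using that host Suc.prems(2) by (simp add: tree_and_host_def tree_and_host_axioms_def)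
  interpret tree_and_host V A r par dep VD AD d using th[OF rt] .
  have max: "dep z \<le> L" if "z \<in> V" for z using that rt L_max[of "dep z"] unfolding height_def by blast
  have "\<exists>g. embedding V g"
  \<comment> \<open>If all paths are short, local injectivity is enough: root the tree at one of two vertices
    with the same image.\<close>
  proof (cases "L < 2 * l")
    case True
    obtain g where g: "local_embedding V g" using local_embedding_exists host(1) by blast
    have "inj_on g V"
    proof (rule inj_onI, rule ccontr)
      fix p q assume pq: "p \<in> V" "q \<in> V" "g p = g q" "p \<noteq> q"
      obtain par' dep' where rt': "rooted_tree V A p par' dep'"
        using Suc.prems(1) pq(1) by (rule oriented_tree_onE)
      interpret S: tree_and_host V A p par' dep' VD AD d using th[OF rt'] .
      have "dep' q \<le> L" using L_max[of "dep' q"] rt' pq(2) unfolding height_def by blast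
      moreover have "0 < dep' q" using S.dep_pos pq by simp
      moreover have walk: "nb_walk (adj AD) (dep' q) (\<lambda>t. g (S.anc t q))"
        using g pq(2) by (intro local_embedding_walk S.ancestor_walk_up) auto
      ultimately have "g (S.anc 0 q) \<noteq> g (S.anc (dep' q) q)"
        using True nb_walk_neq[OF girth walk, of 0 "dep' q"] by auto
      then show False using pq S.anc_dep by simp
    qed
    then show ?thesis using local_embedding_inj g by blast
  next
    case False
    show ?thesis
    proof (rule ccontr)
      assume stuck: "\<nexists>g. embedding V g"
      let ?V = "V - {w}" and ?A = "A \<inter> (V - {w}) \<times> (V - {w})"
      have "w \<noteq> r" using False w l dep_root by auto
      moreover have "children w = {}"
        using max w dep_par by (fastforce simp: children_def)
      ultimately have "oriented_tree_on ?V ?A"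
        using oriented_tree_on_remove_leaf Suc.prems(1) w by blast
      moreover have "card {v. adj ?A u v} \<le> d" if "u \<in> ?V" for u
      proof -
        have "card {v. adj ?A u v} \<le> card {v. adj A u v}"
          using finite_neighbours by (intro card_mono) (auto simp: adj_def)
        also have "\<dots> \<le> d" using Suc.prems(2) that by simp
        finally show ?thesis .
      qed
      moreover have "n = card ?V" using Suc.hyps(2) w by simp
      moreover have "card ?V \<le> l * d + 1" using Suc.prems(3) \<open>n = card ?V\<close> Suc.hyps(2) by simp
      ultimately obtain f where "inj_on f ?V" "\<forall>u\<in>?V. f u \<in> VD"
        "\<forall>u\<in>?V. \<forall>v\<in>?V. (u, v) \<in> ?A \<longrightarrow> (f u, f v) \<in> AD"
        using Suc.hyps(1)[of ?V ?A] by blast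
      then have "embedding ?V f" by (auto simp: embedding_def)
      then interpret stuck_embedding V A r par dep VD AD d l w f
        using l w max False girth stuck by unfold_locales auto
      show False using too_many_vertices Suc.prems(3) by simp
    qed
  qed
  then show ?case by (auto simp: embedding_def)
qed

section \<open>Walks, degrees and trees of pair digraphs\<close>

lemma parcs_mk_symmetric_adj:
  "parcs (mk_symmetric (with_proj G)) = {(u, v). adj (parcs G) u v}"
  by (force simp: parcs_mk_symmetric adj_def)

text \<open>
  Passing to a closed proper segment as long as there is one leaves a closed walk whose vertices
  are distinct. It has at least three arcs, as there are no loops and it does not backtrack.
\<close>

lemma closed_nb_walk_cycle:
  assumes G: "pair_loopfree_digraph G"
    and "nb_walk (adj (parcs G)) n P" "0 < n" "P 0 = P n"
  shows "\<exists>p. underlying_cycle G p \<and> length p \<le> n"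
  using assms(2-)
proof (induction n arbitrary: P rule: less_induct)
  case (less n)
  interpret pair_loopfree_digraph G by (rule G)
  interpret S: pair_wf_digraph "mk_symmetric (with_proj G)" ..
  show ?case
  proof (cases "\<exists>i j. i < j \<and> j \<le> n \<and> j - i < n \<and> P i = P j")
    case True
    then obtain i j where ij: "i < j" "j \<le> n" "j - i < n" "P i = P j" by blast
    have "nb_walk (adj (parcs G)) (j - i) (\<lambda>t. P (i + t))"
      using less.prems(1) ij by (intro nb_walk_segment) auto
    with less.IH[of "j - i" "\<lambda>t. P (i + t)"] ij show ?thesis by fastforce
  next
    case False
    define p where "p = map (\<lambda>t. (P t, P (Suc t))) [0..<n]"
    have adj: "adj (parcs G) (P t) (P (Suc t))" if "t < n" for t
      using that less.prems(1) by (simp add: nb_walk_def)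
    have cas: "pcas (P i) (map (\<lambda>t. (P t, P (Suc t))) [i..<n]) (P n)" if "i \<le> n" for i
      using that by (induction rule: inc_induct) (simp_all add: upt_conv_Cons)
    have p_ne: "p \<noteq> []" using less.prems(2) by (simp add: p_def)
    have "P 0 \<in> pverts G" using adj[of 0] less.prems(2) wellformed' by (auto simp: adj_def)
    then have walk: "S.awalk (P 0) p (P 0)"
      using cas[of 0] less.prems(3) adj unfolding S.awalk_def
      by (auto simp: p_def parcs_mk_symmetric_adj)
    have "tl (pawalk_verts (P 0) p) = map (\<lambda>t. P (Suc t)) [0..<n]"
      using S.awalk_verts_conv'[of "P 0" p "P 0"] walk p_ne
      by (auto simp: S.awalk_def p_def)
    moreover have "inj_on (\<lambda>t. P (Suc t)) {0..<n}"
    proof (rule linorder_inj_onI')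
      fix s t assume "s \<in> {0..<n}" "t \<in> {0..<n}" "s < t"
      then show "P (Suc s) \<noteq> P (Suc t)"
        using False by (metis Suc_leI Suc_less_eq atLeastLessThan_iff diff_Suc_Suc le_less_trans diff_le_self)
    qed
    ultimately have "distinct (tl (pawalk_verts (P 0) p))" by (simp add: distinct_map)
    then have "S.cycle p" using walk p_ne unfolding S.cycle_def by blast
    moreover have "3 \<le> n"
    proof (rule ccontr)
      assume "\<not> 3 \<le> n"
      with less.prems(2) consider "n = 1" | "n = 2" by linarith
      then show False
      proof cases
        case 1
        with adj[of 0] less.prems(3) show False using pair_no_loops by (fastforce simp: adj_def)
      next
        case 2
        with less.prems(1,3) show False by (auto simp: nb_walk_def numeral_2_eq_2)
      qed
    qed
    ultimately have "underlying_cycle G p" by (simp add: underlying_cycle_def p_def)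
    moreover have "length p \<le> n" by (simp add: p_def)
    ultimately show ?thesis by blast
  qed
qed

lemma girth_exceedsI:
  assumes "pair_loopfree_digraph G" "\<And>p. underlying_cycle G p \<Longrightarrow> n < length p"
  shows "girth_exceeds (adj (parcs G)) n"
  unfolding girth_exceeds_def using closed_nb_walk_cycle[OF assms(1)] assms(2)
  by (meson leD le_trans)

lemma less_girth_imp_girth_exceeds:
  assumes "pair_loopfree_digraph G" "enat (Suc n) \<le> girth G"
  shows "girth_exceeds (adj (parcs G)) n"
proof (rule girth_exceedsI[OF assms(1)])
  fix p assume "underlying_cycle G p"
  then have "girth G \<le> enat (length p)" unfolding girth_def by (auto intro: INF_lower)
  with assms(2) have "enat (Suc n) \<le> enat (length p)" by (rule order_trans)
  then show "n < length p" by simp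
qed

text \<open>
  Breadth-first search: the depth is the distance from the root.
\<close>

lemma parent_structure_exists:
  assumes r: "r \<in> V" and conn: "\<And>z. z \<in> V \<Longrightarrow> (r, z) \<in> {(u, v). adj A u v}\<^sup>*"
    and arcs: "A \<subseteq> V \<times> V"
  shows "\<exists>par dep. parent_structure V A r par dep"
proof -
  let ?S = "{(u, v). adj A u v}"
  define dep where "dep z = (LEAST n. (r, z) \<in> ?S ^^ n)" for z
  have dep_walk: "(r, z) \<in> ?S ^^ dep z" if "z \<in> V" for z
    unfolding dep_def by (rule LeastI_ex) (use conn[OF that] rtrancl_imp_relpow in blast)
  have dep_le: "dep z \<le> n" if "(r, z) \<in> ?S ^^ n" for z n
    using that unfolding dep_def by (rule Least_le)
  have "\<exists>y. y \<in> V \<and> adj A y z \<and> dep z = Suc (dep y)" if z: "z \<in> V" "z \<noteq> r" for z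
  proof (cases "dep z")
    case 0
    then show ?thesis using dep_walk[OF z(1)] z(2) by simp
  next
    case (Suc n)
    then obtain y where y: "(r, y) \<in> ?S ^^ n" "adj A y z" using dep_walk[OF z(1)] by auto
    have yV: "y \<in> V" using y(2) arcs by (auto simp: adj_def)
    then have "(r, z) \<in> ?S ^^ Suc (dep y)" using dep_walk y(2) by auto
    then have "dep z \<le> Suc (dep y)" by (rule dep_le)
    with dep_le[OF y(1)] Suc y(2) yV show ?thesis by auto
  qed
  then obtain par where "\<And>z. z \<in> V \<Longrightarrow> z \<noteq> r \<Longrightarrow> par z \<in> V \<and> adj A (par z) z \<and> dep z = Suc (dep (par z))"
    by metis
  moreover have "dep r = 0" using dep_le[of r 0] by simp
  ultimately have "parent_structure V A r par dep" using r by unfold_locales auto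
  then show ?thesis by blast
qed

text \<open>
  If neither end of the edge is the parent of the other, then the edge from \<open>v\<close> to \<open>u\<close>, followed by
  the way from \<open>u\<close> up to the root, is a second walk without backtracking from \<open>v\<close> to the root.
\<close>

lemma (in parent_structure) acyclic_adj_cases:
  assumes acyclic: "\<And>n. girth_exceeds (adj A) n" and uv: "adj A u v" "u \<in> V" "v \<in> V"
  shows "v \<noteq> r \<and> par v = u \<or> u \<noteq> r \<and> par u = v"
proof (cases "u \<noteq> r \<and> par u = v")
  case False
  define P where "P t = (if t = 0 then u else v)" for t :: nat
  define Q where "Q = (\<lambda>t. if t \<le> 1 then P (1 - t) else anc (t - 1) u)"
  have "nb_walk (adj A) 1 P" using uv by (simp add: nb_walk_def P_def)
  moreover have "P 1 \<noteq> anc 1 u" if "0 < dep u"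
    using that False dep_pos[OF uv(2)] by (simp add: P_def anc_def)
  moreover have "P 0 = anc 0 u" by (simp add: P_def)
  ultimately have "nb_walk (adj A) (1 + dep u) Q"
    unfolding Q_def using uv(2) by (intro nb_walk_join[OF symp_adj] ancestor_walk_up) simp_all
  moreover have "nb_walk (adj A) (dep v) (\<lambda>t. anc t v)" using uv(3) by (intro ancestor_walk_up) auto
  moreover have "Q 0 = anc 0 v" by (simp add: Q_def P_def)
  moreover have "Q (1 + dep u) = anc (dep v) v"
    using anc_dep[OF uv(2)] anc_dep[OF uv(3)] by (cases "dep u") (auto simp: Q_def P_def)
  ultimately have "1 + dep u = dep v \<and> (\<forall>i \<le> 1 + dep u. Q i = anc i v)"
    using acyclic symp_adj by (intro nb_walk_unique)
  then have "0 < dep v" "Q 1 = anc 1 v" by auto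
  then show ?thesis using dep_pos[OF uv(3)] by (simp add: Q_def P_def anc_def)
qed blast

lemma oriented_tree_imp_on:
  assumes "oriented_tree T"
  shows "oriented_tree_on (pverts T) (parcs T)"
proof -
  have T: "pair_loopfree_digraph T" "pverts T \<noteq> {}" "finite (pverts T)"
    "Digraph_Component.connected (with_proj T)" "\<nexists>p. underlying_cycle T p"
    and asym: "\<And>u v. (u, v) \<in> parcs T \<Longrightarrow> (v, u) \<notin> parcs T"
    using assms by (auto simp: oriented_tree_def oriented_graph_def)
  interpret pair_loopfree_digraph T by (rule T(1))
  have arcs: "parcs T \<subseteq> pverts T \<times> pverts T" using wellformed' by auto
  have acyclic: "girth_exceeds (adj (parcs T)) n" for n
    using T(5) by (intro girth_exceedsI[OF T(1)]) blast
  have "\<exists>par dep. rooted_tree (pverts T) (parcs T) r par dep" if r: "r \<in> pverts T" for r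
  proof -
    have "(r, z) \<in> {(u, v). adj (parcs T) u v}\<^sup>*" if "z \<in> pverts T" for z
    proof -
      have "(r, z) \<in> rtrancl_on (pverts T) {(u, v). adj (parcs T) u v}"
        using T(4) r that
        by (simp add: connected_def strongly_connected_def reachable_def parcs_mk_symmetric_adj)
      then show ?thesis by (induct rule: rtrancl_on_induct) (auto intro: rtrancl_into_rtrancl)
    qed
    then obtain par dep where "parent_structure (pverts T) (parcs T) r par dep"
      using parent_structure_exists[OF r _ arcs] by blast
    then interpret parent_structure "pverts T" "parcs T" r par dep .
    have "rooted_tree (pverts T) (parcs T) r par dep"
    proof
      fix u v assume uv: "adj (parcs T) u v"
      then have "u \<in> pverts T" "v \<in> pverts T" using wellformed' by (auto simp: adj_def)
      then show "v \<noteq> r \<and> par v = u \<or> u \<noteq> r \<and> par u = v"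
        using acyclic_adj_cases[OF acyclic uv] by blast
    qed (use T(3) arcs asym in auto)
    then show ?thesis by blast
  qed
  with T(2) show ?thesis by (auto simp: oriented_tree_on_def)
qed

lemma out_degree_with_proj: "out_degree (with_proj G) x = card {y. (x, y) \<in> parcs G}"
proof -
  have "out_arcs (with_proj G) x = Pair x ` {y. (x, y) \<in> parcs G}"
    by (auto simp: out_arcs_def)
  then show ?thesis by (simp add: out_degree_def card_image inj_on_def)
qed

lemma in_degree_with_proj: "in_degree (with_proj G) x = card {y. (y, x) \<in> parcs G}"
proof -
  have "in_arcs (with_proj G) x = (\<lambda>y. (y, x)) ` {y. (y, x) \<in> parcs G}"
    by (auto simp: in_arcs_def)
  then show ?thesis by (simp add: in_degree_def card_image inj_on_def)
qed

theorem theorem5: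
  fixes k l :: nat
    and T :: "'b pair_pre_digraph"
    and D :: "'a pair_pre_digraph"
  assumes "l \<ge> 1"
    and "oriented_tree T"
    and "card (parcs T) = k"
    and "oriented_graph D"
    and "real (min_semidegree D) \<ge> max (real k / real l) (real (max_degree T))"
    and "girth D \<ge> enat (2 * l + 1)"
  shows "contains_digraph D T"
proof -
  let ?d = "min_semidegree D"
  have D: "pair_loopfree_digraph D" "pverts D \<noteq> {}"
    using assms(4) by (auto simp: oriented_graph_def)
  interpret D: pair_loopfree_digraph D by (rule D(1))
  have tree: "oriented_tree_on (pverts T) (parcs T)" using assms(2) by (rule oriented_tree_imp_on)
  then obtain r where "r \<in> pverts T" by (auto simp: oriented_tree_on_def)
  with tree obtain par dep where "rooted_tree (pverts T) (parcs T) r par dep"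
    by (rule oriented_tree_onE)
  then interpret T: rooted_tree "pverts T" "parcs T" r par dep .
  have "real k / real l \<le> real ?d" "max_degree T \<le> ?d" using assms(5) by auto
  then have "real k \<le> real l * real ?d" using assms(1) by (simp add: divide_le_eq mult.commute)
  then have "k \<le> l * ?d" by (simp flip: of_nat_mult)
  then have cardV: "card (pverts T) \<le> l * ?d + 1" using T.card_V_le assms(3) by simp
  have deg: "card {v. adj (parcs T) u v} \<le> ?d" if "u \<in> pverts T" for u
  proof -
    have "card {v. adj (parcs T) u v} = out_degree (with_proj (mk_symmetric (with_proj T))) u"
      by (simp add: out_degree_with_proj parcs_mk_symmetric_adj)
    also have "\<dots> \<le> max_degree T"
      unfolding max_degree_def using that T.finite_V by (intro Max_ge) auto
    finally show ?thesis using \<open>max_degree T \<le> ?d\<close> by simp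
  qed
  have "?d \<le> card {y. (x, y) \<in> parcs D}" "?d \<le> card {y. (y, x) \<in> parcs D}" if "x \<in> pverts D" for x
    using that unfolding min_semidegree_def
    by (auto intro!: cInf_lower simp flip: out_degree_with_proj in_degree_with_proj)
  moreover have "parcs D \<subseteq> pverts D \<times> pverts D" using D.wellformed' by auto
  moreover have "girth_exceeds (adj (parcs D)) (2 * l)"
    using assms(6) by (intro less_girth_imp_girth_exceeds[OF D(1)]) simp
  ultimately obtain f where f: "inj_on f (pverts T)" "\<forall>u\<in>pverts T. f u \<in> pverts D"
    "\<forall>u\<in>pverts T. \<forall>v\<in>pverts T. (u, v) \<in> parcs T \<longrightarrow> (f u, f v) \<in> parcs D"
    using oriented_tree_on_embeds[OF tree deg cardV assms(1) D(2)] by blast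
  then show ?thesis
    unfolding contains_digraph_def using T.arcs_in by (intro exI[of _ f]) blast
qed

end
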